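(* Let $(Y_t)_{t=-\infty,\dots,\infty}$ be a stationary ergodic process such that for all $t$, $Y_t\in[0,1]$ almost surely, and such that for all $d\ge1$ the law of $Y_{-d}^{-1}=(Y_{-d},\dots,Y_{-1})$ is regular. Let $M>0$ and let $\ell:[0,1]^2\to[0,1]$ be a (Borel measurable) loss function that is $M$-Lipschitz in its first argument. Assume that a prediction strategy $(\hat Y_t)_{t\ge1}$ satisfies, for all $d\ge1$ and all $L\ge0$, almost surely, \[ \limsup_{T\to\infty}\left(\frac1T\sum_{t=1}^T\ell\bigl(\hat Y_t,Y_t\bigr)\right)\le\limsup_{T\to\infty}\left(\inf_{f\in\mathcal{L}_L^d}\frac1T\sum_{t=1}^T\ell\bigl(f(Y_{t-d}^{t-1}),Y_t\bigr)\right). \] Then, almost surely, \[ \limsup_{T\to\infty}\left(\frac1T\sum_{t=1}^T\ell\bigl(\hat Y_t,Y_t\bigr)\right)\le L^\star . \]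
   Context: A prediction strategy outputs at each time $t\ge1$ a prediction $\hat Y_t\in[0,1]$ of $Y_t$ based on the past observations $Y_1,\dots,Y_{t-1}$. $Y_{t-d}^{t-1}=(Y_{t-d},\dots,Y_{t-1})$. $\mathcal{L}_L^d$ is the set of functions $[0,1]^d\to[0,1]$ that are $L$-Lipschitz for the Euclidean norm. The law of $Y_{-d}^{-1}$ is regular if for every Borel set $S\subset[0,1]^d$ and every $\varepsilon>0$ there are a compact set $K$ and an open set $V$ with $K\subset S\subset V$ and $\mathbb{P}_{Y_{-d}^{-1}}(V\setminus K)\le\varepsilon$. The quantity $L^\star$ is \[ L^\star=\mathbb{E}\left[\inf_{f\in\mathcal{B}^\infty}\mathbb{E}\bigl[\ell\bigl(f(Y_{-\infty}^{-1}),Y_0\bigr)\,\big|\,Y_{-\infty}^{-1}\bigr]\right], \] where $Y_{-\infty}^{-1}=(\dots,Y_{-2},Y_{-1})$, $\mathcal{B}^\infty$ is the set of Borel functions from $[0,1]^\infty$ to $[0,1]$, and the infimum of the family of conditional expectations is understood as an essential infimum (equivalently, computed through a regular conditional distribution of $Y_0$ given $Y_{-\infty}^{-1}$). *)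

theory Defs
  imports "HOL-Probability.Probability"
begin

text \<open>Points of \<open>\<real>\<^sup>d\<close> are extensional functions on \<open>{..<d}\<close>, so that the dimension
  can be quantified over.\<close>

definition cube :: "nat \<Rightarrow> (nat \<Rightarrow> real) set" where
  "cube d = {..<d} \<rightarrow>\<^sub>E {0..1}"

definition lipschitz_class :: "real \<Rightarrow> nat \<Rightarrow> ((nat \<Rightarrow> real) \<Rightarrow> real) set" where
  "lipschitz_class L d =
     {f \<in> cube d \<rightarrow> {0..1}.
        \<forall>x\<in>cube d. \<forall>y\<in>cube d. \<bar>f x - f y\<bar> \<le> L * L2_set (\<lambda>i. x i - y i) {..<d}}"

definition window :: "(int \<Rightarrow> 'a \<Rightarrow> real) \<Rightarrow> int \<Rightarrow> nat \<Rightarrow> 'a \<Rightarrow> nat \<Rightarrow> real" where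
  \<comment> \<open>the vector \<open>(Y\<^sub>s, \<dots>, Y\<^bsub>s+d-1\<^esub>)\<close>\<close>
  "window Y s d \<omega> = (\<lambda>i\<in>{..<d}. Y (s + int i) \<omega>)"

definition stationary :: "'a measure \<Rightarrow> (int \<Rightarrow> 'a \<Rightarrow> real) \<Rightarrow> bool" where
  "stationary P Y \<longleftrightarrow>
     (\<forall>k. distr P (Pi\<^sub>M UNIV (\<lambda>_. borel)) (\<lambda>\<omega> t. Y (t + k) \<omega>)
        = distr P (Pi\<^sub>M UNIV (\<lambda>_. borel)) (\<lambda>\<omega> t. Y t \<omega>))"

definition ergodic :: "'a measure \<Rightarrow> (int \<Rightarrow> 'a \<Rightarrow> real) \<Rightarrow> bool" where
  "ergodic P Y \<longleftrightarrow>
     (\<forall>A \<in> sets (Pi\<^sub>M UNIV (\<lambda>_. borel)). (\<lambda>y t. y (t + 1)) -` A = A \<longrightarrow>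
        measure P {\<omega> \<in> space P. (\<lambda>t. Y t \<omega>) \<in> A} \<in> {0, 1})"

definition regular_law :: "nat \<Rightarrow> (nat \<Rightarrow> real) measure \<Rightarrow> bool" where
  "regular_law d \<mu> \<longleftrightarrow>
     (\<forall>S \<in> sets (Pi\<^sub>M {..<d} (\<lambda>_. borel)). S \<subseteq> cube d \<longrightarrow>
       (\<forall>\<epsilon>>0. \<exists>K V. compactin (product_topology (\<lambda>_. euclideanreal) {..<d}) K \<and>
                   openin (product_topology (\<lambda>_. euclideanreal) {..<d}) V \<and>
                   K \<subseteq> S \<and> S \<subseteq> V \<and> measure \<mu> (V - K) \<le> \<epsilon>))"

definition prediction_strategy :: "(nat \<Rightarrow> (nat \<Rightarrow> real) \<Rightarrow> real) \<Rightarrow> bool" where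
  "prediction_strategy g \<longleftrightarrow> (\<forall>t\<ge>1. g t \<in> cube (t - 1) \<rightarrow> {0..1})"

definition prediction ::
    "(nat \<Rightarrow> (nat \<Rightarrow> real) \<Rightarrow> real) \<Rightarrow> (int \<Rightarrow> 'a \<Rightarrow> real) \<Rightarrow> nat \<Rightarrow> 'a \<Rightarrow> real" where
  "prediction g Y t \<omega> = g t (window Y 1 (t - 1) \<omega>)"

abbreviation unit_borel :: "real measure" where
  "unit_borel \<equiv> restrict_space borel {0..1}"

text \<open>The processes considered lie in \<open>[0,1]\<close> only almost surely, whereas losses and predictors
  are only constrained (in particular, only measurable) on \<open>[0,1]\<close>.  They are therefore composed
  with the following modification, which is almost surely equal to the process; otherwise the
  composition could fail to be measurable, and its \<open>real_cond_exp\<close> would be \<open>0\<close> by convention.\<close>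

definition unit_version :: "(int \<Rightarrow> 'a \<Rightarrow> real) \<Rightarrow> int \<Rightarrow> 'a \<Rightarrow> real" where
  "unit_version Y t \<omega> = (if Y t \<omega> \<in> {0..1} then Y t \<omega> else 0)"

definition past :: "(int \<Rightarrow> 'a \<Rightarrow> real) \<Rightarrow> 'a \<Rightarrow> nat \<Rightarrow> real" where
  \<comment> \<open>coordinate \<open>n\<close> of the infinite past is the observation at time \<open>-1-n\<close>\<close>
  "past Y \<omega> = (\<lambda>n. Y (- 1 - int n) \<omega>)"

definition past_algebra :: "'a measure \<Rightarrow> (int \<Rightarrow> 'a \<Rightarrow> real) \<Rightarrow> 'a measure" where
  "past_algebra P Y = vimage_algebra (space P) (past Y) (Pi\<^sub>M UNIV (\<lambda>_. borel))"

definition borel_predictors :: "((nat \<Rightarrow> real) \<Rightarrow> real) set" where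
  "borel_predictors = Pi\<^sub>M UNIV (\<lambda>_. unit_borel) \<rightarrow>\<^sub>M unit_borel"

text \<open>Essential infimum of a family of random variables, i.e. its infimum for the order
  \<open>\<le>\<close> almost surely; it is unique up to almost sure equality.\<close>

definition is_essential_infimum ::
    "'a measure \<Rightarrow> ('a \<Rightarrow> real) set \<Rightarrow> ('a \<Rightarrow> real) \<Rightarrow> bool" where
  "is_essential_infimum P X Z \<longleftrightarrow>
     Z \<in> borel_measurable P \<and> (\<forall>W\<in>X. AE \<omega> in P. Z \<omega> \<le> W \<omega>) \<and>
     (\<forall>Z'\<in>borel_measurable P. (\<forall>W\<in>X. AE \<omega> in P. Z' \<omega> \<le> W \<omega>) \<longrightarrow> (AE \<omega> in P. Z' \<omega> \<le> Z \<omega>))"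

definition essential_infimum :: "'a measure \<Rightarrow> ('a \<Rightarrow> real) set \<Rightarrow> 'a \<Rightarrow> real" where
  "essential_infimum P X = (SOME Z. is_essential_infimum P X Z)"

definition L_star ::
    "'a measure \<Rightarrow> (real \<Rightarrow> real \<Rightarrow> real) \<Rightarrow> (int \<Rightarrow> 'a \<Rightarrow> real) \<Rightarrow> real" where
  "L_star P loss Y =
     (\<integral>\<omega>. essential_infimum P
        ((\<lambda>f. real_cond_exp P (past_algebra P Y)
                (\<lambda>\<omega>'. loss (f (past (unit_version Y) \<omega>')) (unit_version Y 0 \<omega>'))) ` borel_predictors) \<omega> \<partial>P)"

end

theory Submission
  imports Defs
begin

text \<open>The optimal loss \<open>L_star\<close> is the infimum, over all Borel functions \<open>f\<close> of the infinite past, of the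
  expected loss of \<open>f\<close>. Indeed one may switch between two predictors on an event of the past, so the
  conditional losses form a family directed downwards, and for such a family the essential infimum
  commutes with the expectation (\<open>integral_essential_infimum_directed\<close>, \<open>L_star_eq_INF\<close>).

  Given \<open>c > L_star\<close>, choose \<open>f\<close> with expected loss below \<open>c\<close>. Functions of finitely many past
  observations that are Lipschitz are dense in \<open>L\<^sup>1\<close> of the law of the past
  (\<open>approximable_unit_fun\<close>), and the loss is Lipschitz in the prediction, so \<open>f\<close> can be replaced by a
  function \<open>h\<close> in some class \<open>lipschitz_class L d\<close> whose expected loss is still below \<open>c\<close>
  (\<open>cylinder_loss_less\<close>). The density holds because the sets whose indicators can be
  approximated form a \<open>\<sigma>\<close>-algebra that contains the half-spaces.

  By the ergodic theorem the average loss of the fixed function \<open>h\<close> has upper limit at most \<open>c\<close>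
  almost surely (\<open>limsup_cylinder_loss_le\<close>). The infimum over \<open>lipschitz_class L d\<close> of the average losses is no
  larger at any time, and by hypothesis the strategy is asymptotically at least as good as this
  infimum. Letting \<open>c\<close> decrease to \<open>L_star\<close> along a sequence gives the claim. The upper half of the
  ergodic theorem, which bounds the averages from above, follows from the behaviour of the running maximum of the Birkhoff sums
  (\<open>birkhoff_sums_bounded_above\<close>).\<close>

section \<open>An upper ergodic bound\<close>

text \<open>The maximum of \<open>0, S\<^sub>1, \<dots>, S\<^sub>n\<close>, where \<open>S\<^sub>k\<close> is the sum of \<open>G\<close> over the first \<open>k\<close> points of the
  orbit of \<open>x\<close>. It is given by its recursion along the orbit because that recursion is what the
  ergodic argument uses.\<close>
primrec max_birkhoff_sum :: "('a \<Rightarrow> real) \<Rightarrow> ('a \<Rightarrow> 'a) \<Rightarrow> nat \<Rightarrow> 'a \<Rightarrow> real" where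
  "max_birkhoff_sum G T 0 x = 0"
| "max_birkhoff_sum G T (Suc n) x = max 0 (G x + max_birkhoff_sum G T n (T x))"

lemma birkhoff_sum_le_max: "(\<Sum>k<n. G ((T ^^ k) x)) \<le> max_birkhoff_sum G T n x"
proof (induction n arbitrary: x)
  case (Suc n)
  have "(\<Sum>k<Suc n. G ((T ^^ k) x)) = G x + (\<Sum>k<n. G ((T ^^ k) (T x)))"
    by (subst sum.lessThan_Suc_shift) (simp add: funpow_swap1)
  then show ?case using Suc[of "T x"] by simp
qed simp

lemma max_birkhoff_sum_nonneg: "0 \<le> max_birkhoff_sum G T n x"
  by (cases n) auto

lemma max_birkhoff_sum_mono:
  assumes "m \<le> n"
  shows "max_birkhoff_sum G T m x \<le> max_birkhoff_sum G T n x"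
  using _ assms
proof (rule lift_Suc_mono_le)
  have "max_birkhoff_sum G T n x \<le> max_birkhoff_sum G T (Suc n) x" for n x
  proof (induction n arbitrary: x)
    case (Suc n)
    from Suc[of "T x"] show ?case by auto
  qed simp
  then show "max_birkhoff_sum G T n x \<le> max_birkhoff_sum G T (Suc n) x" for n .
qed

lemma max_birkhoff_sum_le:
  assumes "T \<in> S \<rightarrow> S" and "\<And>x. x \<in> S \<Longrightarrow> \<bar>G x\<bar> \<le> B" and "x \<in> S"
  shows "max_birkhoff_sum G T n x \<le> real n * B"
  using assms(3)
proof (induction n arbitrary: x)
  case (Suc n)
  have "max_birkhoff_sum G T n (T x) \<le> real n * B" using Suc assms(1) by auto
  moreover have "G x \<le> B" "0 \<le> B" using assms(2)[OF Suc.prems] by auto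
  ultimately show ?case by (auto simp: algebra_simps)
qed simp

lemma max_birkhoff_sum_measurable [measurable]:
  assumes [measurable]: "T \<in> N \<rightarrow>\<^sub>M N" "G \<in> borel_measurable N"
  shows "max_birkhoff_sum G T n \<in> borel_measurable N"
proof (induction n)
  case (Suc n)
  note [measurable] = Suc
  show ?case by simp
qed (simp add: fun_eq_iff)

text \<open>Let \<open>m n\<close> be the maximum of the first \<open>n\<close> Birkhoff sums. Its recursion gives
  \<open>m (n + 1) - m n \<circ> T = max (- m n \<circ> T) G\<close>, and the left-hand side has nonnegative integral
  because \<open>T\<close> preserves the measure and \<open>m\<close> increases with \<open>n\<close>. The event that \<open>m n\<close> is unbounded
  is invariant. If it had probability one, the right-hand side would tend to \<open>G\<close> boundedly, so
  that \<open>G\<close> would have nonnegative integral. By ergodicity the event therefore has probability zero.\<close>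
lemma birkhoff_sums_bounded_above:
  fixes G :: "'a \<Rightarrow> real"
  assumes "prob_space N"
    and T [measurable]: "T \<in> N \<rightarrow>\<^sub>M N" and preserving: "distr N N T = N"
    and ergodic: "\<And>A. A \<in> sets N \<Longrightarrow> T -` A \<inter> space N = A \<Longrightarrow> measure N A \<in> {0, 1}"
    and G [measurable]: "G \<in> borel_measurable N" and bound: "\<And>x. x \<in> space N \<Longrightarrow> \<bar>G x\<bar> \<le> B"
    and negative: "(\<integral>x. G x \<partial>N) < 0"
  shows "AE x in N. \<exists>b. \<forall>n. (\<Sum>k<n. G ((T ^^ k) x)) \<le> b"
proof -
  interpret prob_space N by fact
  let ?m = "max_birkhoff_sum G T"
  have Tspace: "T x \<in> space N" if "x \<in> space N" for x
    using measurable_space[OF T that] .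
  define E where "E = {x \<in> space N. \<forall>b::nat. \<exists>n. real b < ?m n x}"
  have E [measurable]: "E \<in> sets N" unfolding E_def by measurable
  have unbounded_iff: "x \<in> E \<longleftrightarrow> (\<forall>b. \<exists>n. b < ?m n x)" if "x \<in> space N" for x
  proof
    assume "x \<in> E"
    show "\<forall>b. \<exists>n. b < ?m n x"
    proof
      fix b
      obtain k :: nat where "b < real k" using reals_Archimedean2 by blast
      moreover obtain n where "real k < ?m n x" using \<open>x \<in> E\<close> unfolding E_def by blast
      ultimately show "\<exists>n. b < ?m n x" by (intro exI[of _ n]) linarith
    qed
  next
    assume "\<forall>b. \<exists>n. b < ?m n x"
    with that show "x \<in> E" unfolding E_def by simp
  qed
  have invariant: "T -` E \<inter> space N = E"
  proof -
    have "x \<in> E \<longleftrightarrow> T x \<in> E" if x: "x \<in> space N" for x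
    proof
      assume "x \<in> E"
      show "T x \<in> E" unfolding unbounded_iff[OF Tspace[OF x]]
      proof
        fix b
        obtain n where n: "max 0 (G x + b) < ?m n x"
          using \<open>x \<in> E\<close> unfolding unbounded_iff[OF x] by blast
        then obtain k where "n = Suc k" by (cases n) auto
        with n show "\<exists>n. b < ?m n (T x)" by (intro exI[of _ k]) auto
      qed
    next
      assume "T x \<in> E"
      show "x \<in> E" unfolding unbounded_iff[OF x]
      proof
        fix b
        obtain n where "b - G x < ?m n (T x)"
          using \<open>T x \<in> E\<close> unfolding unbounded_iff[OF Tspace[OF x]] by blast
        then show "\<exists>n. b < ?m n x" by (intro exI[of _ "Suc n"]) auto
      qed
    qed
    moreover have "E \<subseteq> space N" unfolding E_def by auto
    ultimately show ?thesis by auto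
  qed
  have "prob E \<noteq> 1"
  proof
    assume "prob E = 1"
    then have AE_E: "AE x in N. x \<in> E" by (simp add: AE_in_set_eq_1)
    have int: "integrable N (?m n)" for n
      using max_birkhoff_sum_le[of T "space N" G B, OF _ bound] Tspace
      by (intro integrable_const_bound[where B="real n * B"] AE_I2)
         (auto simp: max_birkhoff_sum_nonneg)
    have int_shift: "integrable N (\<lambda>x. ?m n (T x))"
      "(\<integral>x. ?m n (T x) \<partial>N) = (\<integral>x. ?m n x \<partial>N)" for n
      using integrable_distr_eq[OF T, of "?m n"] integral_distr[OF T, of "?m n"] int[of n]
      by (auto simp: preserving)
    \<comment> \<open>\<open>D n\<close> is the increment \<open>?m (Suc n) - ?m n \<circ> T\<close>, in a form that exhibits its limit.\<close>
    define D where "D n x = max (- ?m n (T x)) (G x)" for n x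
    have D_nonneg: "0 \<le> (\<integral>x. D n x \<partial>N)" for n
    proof -
      have "D n x = ?m (Suc n) x - ?m n (T x)" for x by (auto simp: D_def)
      then have "(\<integral>x. D n x \<partial>N) = (\<integral>x. ?m (Suc n) x \<partial>N) - (\<integral>x. ?m n (T x) \<partial>N)"
        using int int_shift by (simp del: max_birkhoff_sum.simps)
      moreover have "(\<integral>x. ?m n x \<partial>N) \<le> (\<integral>x. ?m (Suc n) x \<partial>N)"
        by (intro integral_mono int max_birkhoff_sum_mono) auto
      ultimately show ?thesis by (simp add: int_shift)
    qed
    have "(\<lambda>n. \<integral>x. D n x \<partial>N) \<longlonglongrightarrow> (\<integral>x. G x \<partial>N)"
    proof (rule integral_dominated_convergence[where w="\<lambda>_. B"])
      show "AE x in N. (\<lambda>n. D n x) \<longlonglongrightarrow> G x"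
        using AE_E
      proof eventually_elim
        case (elim x)
        then have x: "x \<in> space N" unfolding E_def by auto
        have "T x \<in> E" using elim invariant by auto
        then obtain n where "- G x < ?m n (T x)"
          unfolding unbounded_iff[OF Tspace[OF x]] by blast
        then have "D k x = G x" if "k \<ge> n" for k
          using max_birkhoff_sum_mono[OF that, of G T "T x"] by (auto simp: D_def)
        then show ?case by (intro tendsto_eventually) (auto simp: eventually_sequentially)
      qed
      show "AE x in N. norm (D n x) \<le> B" for n
      proof (rule AE_I2)
        fix x assume "x \<in> space N"
        from bound[OF this] max_birkhoff_sum_nonneg[of G T n "T x"]
        show "norm (D n x) \<le> B" by (auto simp: D_def)
      qed
    qed (auto simp: D_def)
    then have "0 \<le> (\<integral>x. G x \<partial>N)" by (rule LIMSEQ_le_const) (use D_nonneg in auto)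
    with negative show False by simp
  qed
  then have "prob E = 0" using ergodic[OF E invariant] by auto
  then have "AE x in N. x \<notin> E" by (simp add: AE_iff_measurable[OF E] emeasure_eq_measure E_def)
  then show ?thesis using AE_space
  proof eventually_elim
    case (elim x)
    then obtain b where "\<forall>n. \<not> b < ?m n x" unfolding unbounded_iff[OF elim(2)] by auto
    then have "(\<Sum>k<n. G ((T ^^ k) x)) \<le> b" for n
      using birkhoff_sum_le_max[of G T x n] by (meson not_less order_trans)
    then show ?case by blast
  qed
qed

text \<open>The upper half of Birkhoff's ergodic theorem: the Birkhoff sums of \<open>F \<circ> T - c\<close>, a function of
  negative mean, are bounded above, and the bound disappears after division by \<open>n\<close>. The sums
  start at time \<open>1\<close>, in accordance with the time at which predictions start.\<close>
lemma limsup_birkhoff_average_le: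
  assumes "prob_space N"
    and T [measurable]: "T \<in> N \<rightarrow>\<^sub>M N" and preserving: "distr N N T = N"
    and ergodic: "\<And>A. A \<in> sets N \<Longrightarrow> T -` A \<inter> space N = A \<Longrightarrow> measure N A \<in> {0, 1}"
    and F [measurable]: "F \<in> borel_measurable N" and bound: "\<And>x. x \<in> space N \<Longrightarrow> \<bar>F x\<bar> \<le> B"
    and less: "(\<integral>x. F x \<partial>N) < c"
  shows "AE x in N. limsup (\<lambda>n. ereal (1 / real n * (\<Sum>t=1..n. F ((T ^^ t) x)))) \<le> ereal c"
proof -
  interpret prob_space N by fact
  define G where "G x = F (T x) - c" for x
  have FT: "integrable N (\<lambda>x. F (T x))"
    using bound measurable_space[OF T] by (intro integrable_const_bound[where B=B] AE_I2) auto
  have "(\<integral>x. G x \<partial>N) = (\<integral>x. F (T x) \<partial>N) - c"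
    unfolding G_def using FT by (simp add: prob_space)
  also have "(\<integral>x. F (T x) \<partial>N) = (\<integral>x. F x \<partial>N)"
    using integral_distr[OF T, of F] by (simp add: preserving)
  finally have neg: "(\<integral>x. G x \<partial>N) < 0" using less by simp
  have "\<bar>G x\<bar> \<le> B + \<bar>c\<bar>" if "x \<in> space N" for x
    using bound[OF measurable_space[OF T that]] unfolding G_def by linarith
  moreover have "G \<in> borel_measurable N" unfolding G_def by measurable
  ultimately have "AE x in N. \<exists>b. \<forall>n. (\<Sum>k<n. G ((T ^^ k) x)) \<le> b"
    using neg by (intro birkhoff_sums_bounded_above[OF assms(1) T preserving ergodic])
  then show ?thesis
  proof eventually_elim
    case (elim x)
    then obtain b where b: "\<And>n. (\<Sum>k<n. G ((T ^^ k) x)) \<le> b" by blast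
    have average: "1 / real n * (\<Sum>t=1..n. F ((T ^^ t) x)) \<le> c + b / real n" if "n > 0" for n
    proof -
      have "(\<Sum>k<n. G ((T ^^ k) x)) = (\<Sum>t=1..n. F ((T ^^ t) x)) - real n * c"
        by (simp add: G_def sum_subtractf sum.atLeast1_atMost_eq)
      with b[of n] have "(\<Sum>t=1..n. F ((T ^^ t) x)) \<le> real n * c + b" by simp
      with that show ?thesis by (simp add: field_simps)
    qed
    have "limsup (\<lambda>n. ereal (1 / real n * (\<Sum>t=1..n. F ((T ^^ t) x))))
        \<le> limsup (\<lambda>n. ereal (c + b / real n))"
      using average by (intro Limsup_mono) (auto simp: eventually_sequentially intro!: exI[of _ 1])
    also have "\<dots> = ereal c"
    proof (rule lim_imp_Limsup)
      have "(\<lambda>n. c + b / real n) \<longlonglongrightarrow> c + 0" by (intro tendsto_intros lim_const_over_n)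
      then show "(\<lambda>n. ereal (c + b / real n)) \<longlonglongrightarrow> ereal c" by simp
    qed simp
    finally show ?case .
  qed
qed

section \<open>Essential infima of directed families\<close>

text \<open>Directedness is only required almost surely, since conditional expectations are only defined
  up to null sets.\<close>
definition directed_below :: "'a measure \<Rightarrow> ('i \<Rightarrow> 'a \<Rightarrow> real) \<Rightarrow> 'i set \<Rightarrow> bool" where
  "directed_below P W I \<longleftrightarrow>
     (\<forall>i\<in>I. \<forall>j\<in>I. \<exists>k\<in>I. AE \<omega> in P. W k \<omega> \<le> min (W i \<omega>) (W j \<omega>))"

text \<open>Directedness yields an almost surely decreasing sequence of members \<open>W (k n)\<close> whose integrals
  tend to the infimum \<open>m\<close> of all integrals. Its pointwise limit \<open>Z\<close> has integral \<open>m\<close>. It lies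
  below every member \<open>W i\<close>: for each \<open>n\<close> some member lies below both \<open>W (k n)\<close> and \<open>W i\<close>, so the
  integral of \<open>min (W (k n)) (W i)\<close> is at least \<open>m\<close>; in the limit the integral of \<open>min Z (W i)\<close> is
  at least that of \<open>Z\<close>, which forces \<open>min Z (W i) = Z\<close> almost surely.\<close>
lemma essential_infimum_directed:
  assumes "I \<noteq> {}" and directed: "directed_below P W I"
    and int: "\<And>i. i \<in> I \<Longrightarrow> integrable P (W i)"
    and nonneg: "\<And>i. i \<in> I \<Longrightarrow> AE \<omega> in P. 0 \<le> W i \<omega>"
  obtains Z where "is_essential_infimum P (W ` I) Z" "integrable P Z"
    and "(\<integral>\<omega>. Z \<omega> \<partial>P) = (INF i\<in>I. \<integral>\<omega>. W i \<omega> \<partial>P)"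
proof -
  define m where "m = (INF i\<in>I. \<integral>\<omega>. W i \<omega> \<partial>P)"
  have meas [measurable]: "W i \<in> borel_measurable P" if "i \<in> I" for i
    using int[OF that] by auto
  have bdd: "bdd_below ((\<lambda>i. \<integral>\<omega>. W i \<omega> \<partial>P) ` I)"
    using nonneg by (intro bdd_belowI2[where m=0] integral_nonneg_AE) auto
  have m_le: "m \<le> (\<integral>\<omega>. W i \<omega> \<partial>P)" if "i \<in> I" for i
    unfolding m_def using bdd that by (rule cINF_lower)
  have near: "\<exists>i\<in>I. (\<integral>\<omega>. W i \<omega> \<partial>P) < m + 1 / real (Suc n)" for n
    using cInf_less_iff[of "(\<lambda>i. \<integral>\<omega>. W i \<omega> \<partial>P) ` I" "m + 1 / real (Suc n)"] bdd \<open>I \<noteq> {}\<close>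
    by (auto simp: m_def)
  have "\<exists>k. \<forall>n. (k n \<in> I \<and> (\<integral>\<omega>. W (k n) \<omega> \<partial>P) < m + 1 / real (Suc n)) \<and>
      (AE \<omega> in P. W (k (Suc n)) \<omega> \<le> W (k n) \<omega>)"
  proof (rule dependent_nat_choice, goal_cases)
    case 1
    then show ?case using near[of 0] by auto
  next
    case (2 i n)
    obtain j where j: "j \<in> I" "(\<integral>\<omega>. W j \<omega> \<partial>P) < m + 1 / real (Suc (Suc n))" using near by blast
    obtain l where l: "l \<in> I" "AE \<omega> in P. W l \<omega> \<le> min (W i \<omega>) (W j \<omega>)"
      using directed 2 j(1) unfolding directed_below_def by blast
    have "(\<integral>\<omega>. W l \<omega> \<partial>P) \<le> (\<integral>\<omega>. W j \<omega> \<partial>P)"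
      using l j by (intro integral_mono_AE int) auto
    with j(2) l show ?case by (intro exI[of _ l]) auto
  qed
  then obtain k where kI: "\<And>n. k n \<in> I"
    and k_near: "\<And>n. (\<integral>\<omega>. W (k n) \<omega> \<partial>P) < m + 1 / real (Suc n)"
    and k_step: "\<And>n. AE \<omega> in P. W (k (Suc n)) \<omega> \<le> W (k n) \<omega>" by blast
  have [measurable]: "W (k n) \<in> borel_measurable P" for n using kI meas by blast
  have AE_k: "AE \<omega> in P. (\<forall>n. 0 \<le> W (k n) \<omega>) \<and> (\<forall>n. W (k (Suc n)) \<omega> \<le> W (k n) \<omega>)"
    using k_step nonneg[OF kI] by (auto simp: AE_all_countable AE_conj_iff)
  \<comment> \<open>The members are nonnegative only almost surely; truncation at \<open>0\<close> keeps the infimum of reals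
    from being taken over a set that is unbounded below.\<close>
  define Z where "Z \<omega> = (INF n. max 0 (W (k n) \<omega>))" for \<omega>
  have bddk: "bdd_below (range (\<lambda>n. max 0 (W (k n) \<omega>)))" for \<omega>
    by (intro bdd_belowI2[where m=0]) auto
  have Z_meas [measurable]: "Z \<in> borel_measurable P"
    unfolding Z_def by (intro borel_measurable_cINF bddk) auto
  have Z_le: "Z \<omega> \<le> max 0 (W (k n) \<omega>)" for \<omega> n
    unfolding Z_def by (intro cINF_lower bddk) auto
  have Z_nonneg: "0 \<le> Z \<omega>" for \<omega>
    unfolding Z_def by (intro cINF_greatest) auto
  have Z_lim: "AE \<omega> in P. (\<lambda>n. W (k n) \<omega>) \<longlonglongrightarrow> Z \<omega>"
    using AE_k
  proof eventually_elim
    case (elim \<omega>)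
    then have "decseq (\<lambda>n. W (k n) \<omega>)" by (intro decseq_SucI) auto
    moreover have "bdd_below (range (\<lambda>n. W (k n) \<omega>))" using elim by (intro bdd_belowI2[where m=0]) auto
    ultimately have "(\<lambda>n. W (k n) \<omega>) \<longlonglongrightarrow> (INF n. W (k n) \<omega>)" by (intro LIMSEQ_decseq_INF)
    then show ?case using elim by (simp add: Z_def max_absorb2)
  qed
  have Z_int: "integrable P Z"
  proof (rule Bochner_Integration.integrable_bound[OF int[OF kI[of 0]]])
    show "AE \<omega> in P. norm (Z \<omega>) \<le> norm (W (k 0) \<omega>)" using AE_k
    proof eventually_elim
      case (elim \<omega>)
      then show ?case using Z_le[of \<omega> 0] Z_nonneg[of \<omega>] by (simp add: max_absorb2)
    qed
  qed simp
  have Z_upper: "(\<integral>\<omega>. Z \<omega> \<partial>P) \<le> m"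
  proof (rule field_le_epsilon)
    fix e :: real assume "0 < e"
    then obtain n where n: "1 / real (Suc n) < e" using nat_approx_posE by blast
    have "(\<integral>\<omega>. Z \<omega> \<partial>P) \<le> (\<integral>\<omega>. W (k n) \<omega> \<partial>P)"
    proof (intro integral_mono_AE Z_int int kI)
      show "AE \<omega> in P. Z \<omega> \<le> W (k n) \<omega>" using AE_k
      proof eventually_elim
        case (elim \<omega>)
        then show ?case using Z_le[of \<omega> n] by (simp add: max_absorb2)
      qed
    qed
    with k_near[of n] n show "(\<integral>\<omega>. Z \<omega> \<partial>P) \<le> m + e" by linarith
  qed
  have lower: "m \<le> (\<integral>\<omega>. min (Z \<omega>) (W i \<omega>) \<partial>P)" if i: "i \<in> I" for i
  proof -
    note [measurable] = meas[OF i]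
    have "(\<lambda>n. \<integral>\<omega>. min (W (k n) \<omega>) (W i \<omega>) \<partial>P) \<longlonglongrightarrow> (\<integral>\<omega>. min (Z \<omega>) (W i \<omega>) \<partial>P)"
    proof (rule integral_dominated_convergence[where w="W i"])
      show "AE \<omega> in P. (\<lambda>n. min (W (k n) \<omega>) (W i \<omega>)) \<longlonglongrightarrow> min (Z \<omega>) (W i \<omega>)"
        using Z_lim by eventually_elim (intro tendsto_min tendsto_const)
      show "AE \<omega> in P. norm (min (W (k n) \<omega>) (W i \<omega>)) \<le> W i \<omega>" for n
        using AE_k nonneg[OF i] by eventually_elim auto
    qed (use int i in auto)
    moreover have "m \<le> (\<integral>\<omega>. min (W (k n) \<omega>) (W i \<omega>) \<partial>P)" for n
    proof -
      obtain l where l: "l \<in> I" "AE \<omega> in P. W l \<omega> \<le> min (W (k n) \<omega>) (W i \<omega>)"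
        using directed kI i unfolding directed_below_def by blast
      have "m \<le> (\<integral>\<omega>. W l \<omega> \<partial>P)" by (rule m_le[OF l(1)])
      also have "\<dots> \<le> (\<integral>\<omega>. min (W (k n) \<omega>) (W i \<omega>) \<partial>P)"
        using l kI i by (intro integral_mono_AE integrable_min int) auto
      finally show ?thesis .
    qed
    ultimately show ?thesis by (intro LIMSEQ_le_const) auto
  qed
  have Z_below: "AE \<omega> in P. Z \<omega> \<le> W i \<omega>" if i: "i \<in> I" for i
  proof -
    have min_int: "integrable P (\<lambda>\<omega>. min (Z \<omega>) (W i \<omega>))" using Z_int int[OF i] by (rule integrable_min)
    have "(\<integral>\<omega>. Z \<omega> - min (Z \<omega>) (W i \<omega>) \<partial>P) = 0"
    proof (rule antisym)
      show "(\<integral>\<omega>. Z \<omega> - min (Z \<omega>) (W i \<omega>) \<partial>P) \<le> 0"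
        using Z_upper lower[OF i] by (simp add: Z_int min_int)
    qed (auto intro!: integral_nonneg_AE)
    then have "AE \<omega> in P. Z \<omega> - min (Z \<omega>) (W i \<omega>) = 0"
      using integral_nonneg_eq_0_iff_AE[of P "\<lambda>\<omega>. Z \<omega> - min (Z \<omega>) (W i \<omega>)"] Z_int min_int by auto
    then show ?thesis by eventually_elim (auto simp: min_def split: if_splits)
  qed
  have "is_essential_infimum P (W ` I) Z"
    unfolding is_essential_infimum_def
  proof (intro conjI ballI impI)
    fix Z' assume "\<forall>V\<in>W ` I. AE \<omega> in P. Z' \<omega> \<le> V \<omega>"
    then have "AE \<omega> in P. \<forall>n. Z' \<omega> \<le> W (k n) \<omega>" using kI by (auto simp: AE_all_countable)
    then show "AE \<omega> in P. Z' \<omega> \<le> Z \<omega>"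
    proof eventually_elim
      case (elim \<omega>)
      then show ?case unfolding Z_def by (intro cINF_greatest) (auto simp: le_max_iff_disj)
    qed
  qed (use Z_below in auto)
  moreover obtain i where "i \<in> I" using \<open>I \<noteq> {}\<close> by auto
  moreover have "(\<integral>\<omega>. min (Z \<omega>) (W i \<omega>) \<partial>P) \<le> (\<integral>\<omega>. Z \<omega> \<partial>P)" if "i \<in> I" for i
    by (intro integral_mono integrable_min Z_int int that) auto
  ultimately show ?thesis using that Z_int Z_upper lower unfolding m_def by (meson antisym order_trans)
qed

lemma integral_essential_infimum_directed:
  assumes "I \<noteq> {}" and "directed_below P W I"
    and "\<And>i. i \<in> I \<Longrightarrow> integrable P (W i)"
    and "\<And>i. i \<in> I \<Longrightarrow> AE \<omega> in P. 0 \<le> W i \<omega>"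
  shows "(\<integral>\<omega>. essential_infimum P (W ` I) \<omega> \<partial>P) = (INF i\<in>I. \<integral>\<omega>. W i \<omega> \<partial>P)"
proof -
  obtain Z where Z: "is_essential_infimum P (W ` I) Z"
    and Z_int: "(\<integral>\<omega>. Z \<omega> \<partial>P) = (INF i\<in>I. \<integral>\<omega>. W i \<omega> \<partial>P)"
    using essential_infimum_directed[OF assms] by blast
  define E where "E = essential_infimum P (W ` I)"
  have E: "is_essential_infimum P (W ` I) E"
    unfolding E_def essential_infimum_def by (rule someI[of "is_essential_infimum P (W ` I)", OF Z])
  from E Z have [measurable]: "E \<in> borel_measurable P" "Z \<in> borel_measurable P"
    unfolding is_essential_infimum_def by auto
  have "AE \<omega> in P. E \<omega> \<le> Z \<omega>" "AE \<omega> in P. Z \<omega> \<le> E \<omega>"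
    using E Z unfolding is_essential_infimum_def by auto
  then have "AE \<omega> in P. E \<omega> = Z \<omega>" by eventually_elim simp
  then have "(\<integral>\<omega>. E \<omega> \<partial>P) = (\<integral>\<omega>. Z \<omega> \<partial>P)" by (intro integral_cong_AE) auto
  with Z_int show ?thesis by (simp add: E_def)
qed

section \<open>Approximation by Lipschitz functions of finitely many coordinates\<close>

abbreviation seq_borel :: "(nat \<Rightarrow> real) measure" where
  "seq_borel \<equiv> Pi\<^sub>M UNIV (\<lambda>_. borel)"

text \<open>A Lipschitz bound that involves only the first \<open>d\<close> coordinates also says that the function
  depends on nothing else. The \<open>\<ell>\<^sup>1\<close> distance
  makes sums over different numbers of coordinates easy to compare; the passage to the Euclidean
  distance only changes the constant.\<close>
definition lipschitz_cylinder :: "((nat \<Rightarrow> real) \<Rightarrow> real) \<Rightarrow> bool" where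
  "lipschitz_cylinder \<phi> \<longleftrightarrow>
     \<phi> \<in> borel_measurable seq_borel \<and> (\<forall>x. \<phi> x \<in> {0..1}) \<and>
     (\<exists>d L. 0 \<le> L \<and> (\<forall>x y. \<bar>\<phi> x - \<phi> y\<bar> \<le> L * (\<Sum>n<d. \<bar>x n - y n\<bar>)))"

lemma lipschitz_cylinderI:
  assumes "\<phi> \<in> borel_measurable seq_borel" "\<And>x. \<phi> x \<in> {0..1}" "0 \<le> L"
    and "\<And>x y. \<bar>\<phi> x - \<phi> y\<bar> \<le> L * (\<Sum>n<d. \<bar>x n - y n\<bar>)"
  shows "lipschitz_cylinder \<phi>"
  using assms unfolding lipschitz_cylinder_def by blast

lemma lipschitz_cylinderD:
  assumes "lipschitz_cylinder \<phi>"
  shows "\<phi> \<in> borel_measurable seq_borel" "0 \<le> \<phi> x" "\<phi> x \<le> 1"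
  using assms unfolding lipschitz_cylinder_def by auto

lemma lipschitz_cylinder_const: "c \<in> {0..1} \<Longrightarrow> lipschitz_cylinder (\<lambda>_. c)"
  by (rule lipschitz_cylinderI[where L=0 and d=0]) auto

text \<open>The operations on functions with values in \<open>[0,1]\<close> under which Lipschitz functions, and then
  their \<open>L\<^sup>1\<close> limits, are stable. Complements and products yield the Boolean operations on
  indicators, and convex combinations yield simple functions.\<close>
definition unit_connective :: "(real \<Rightarrow> real \<Rightarrow> real) \<Rightarrow> bool" where
  "unit_connective C \<longleftrightarrow>
     (\<lambda>(a, b). C a b) \<in> borel_measurable (borel \<Otimes>\<^sub>M borel) \<and>
     (\<forall>a\<in>{0..1}. \<forall>b\<in>{0..1}. C a b \<in> {0..1} \<and>
        (\<forall>c\<in>{0..1}. \<forall>d\<in>{0..1}. \<bar>C a b - C c d\<bar> \<le> \<bar>a - c\<bar> + \<bar>b - d\<bar>))"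

lemma unit_connective_compose_measurable:
  assumes C: "unit_connective C" and [measurable]: "f \<in> borel_measurable N" "g \<in> borel_measurable N"
  shows "(\<lambda>x. C (f x) (g x)) \<in> borel_measurable N"
proof -
  have "(\<lambda>x. (f x, g x)) \<in> N \<rightarrow>\<^sub>M borel \<Otimes>\<^sub>M borel" by measurable
  from measurable_compose[OF this] C show ?thesis unfolding unit_connective_def by fastforce
qed

lemma unit_connective_compl: "unit_connective (\<lambda>a b. 1 - a)"
  by (auto simp: unit_connective_def)

lemma unit_connective_mult: "unit_connective (\<lambda>a b. a * b)"
proof -
  have "\<bar>a * b - c * d\<bar> \<le> \<bar>a - c\<bar> + \<bar>b - d\<bar>" if "a \<in> {0..1}" "d \<in> {0..1}" for a b c d :: real
  proof -
    have "a * b - c * d = (a - c) * d + a * (b - d)" by (simp add: algebra_simps)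
    also have "\<bar>\<dots>\<bar> \<le> \<bar>a - c\<bar> * d + a * \<bar>b - d\<bar>"
      using that abs_triangle_ineq[of "(a - c) * d" "a * (b - d)"] by (simp add: abs_mult)
    also have "\<dots> \<le> \<bar>a - c\<bar> * 1 + 1 * \<bar>b - d\<bar>"
      using that by (intro add_mono mult_left_mono mult_right_mono) auto
    finally show ?thesis by simp
  qed
  then show ?thesis by (auto simp: unit_connective_def intro: mult_le_one)
qed

lemma unit_connective_convex:
  assumes t: "t \<in> {0..1}"
  shows "unit_connective (\<lambda>a b. t * a + (1 - t) * b)"
proof -
  have "\<bar>t * a + (1 - t) * b - (t * c + (1 - t) * d)\<bar> \<le> \<bar>a - c\<bar> + \<bar>b - d\<bar>" for a b c d
  proof -
    have "t * a + (1 - t) * b - (t * c + (1 - t) * d) = t * (a - c) + (1 - t) * (b - d)"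
      by (simp add: algebra_simps)
    also have "\<bar>\<dots>\<bar> \<le> t * \<bar>a - c\<bar> + (1 - t) * \<bar>b - d\<bar>"
      using t abs_triangle_ineq[of "t * (a - c)" "(1 - t) * (b - d)"] by (simp add: abs_mult)
    also have "\<dots> \<le> 1 * \<bar>a - c\<bar> + 1 * \<bar>b - d\<bar>"
      using t by (intro add_mono mult_right_mono) auto
    finally show ?thesis by simp
  qed
  then show ?thesis using t by (auto simp: unit_connective_def intro!: convex_bound_le)
qed

lemma lipschitz_cylinder_combine:
  assumes C: "unit_connective C" and \<phi>: "lipschitz_cylinder \<phi>" and \<psi>: "lipschitz_cylinder \<psi>"
  shows "lipschitz_cylinder (\<lambda>x. C (\<phi> x) (\<psi> x))"
proof -
  obtain d L where L: "0 \<le> L" "\<And>x y. \<bar>\<phi> x - \<phi> y\<bar> \<le> L * (\<Sum>n<d. \<bar>x n - y n\<bar>)"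
    using \<phi> unfolding lipschitz_cylinder_def by blast
  obtain e K where K: "0 \<le> K" "\<And>x y. \<bar>\<psi> x - \<psi> y\<bar> \<le> K * (\<Sum>n<e. \<bar>x n - y n\<bar>)"
    using \<psi> unfolding lipschitz_cylinder_def by blast
  have range: "\<phi> x \<in> {0..1}" "\<psi> x \<in> {0..1}" for x
    using \<phi> \<psi> by (auto simp: lipschitz_cylinder_def)
  show ?thesis
  proof (rule lipschitz_cylinderI[where L="L + K" and d="max d e"])
    show "(\<lambda>x. C (\<phi> x) (\<psi> x)) \<in> borel_measurable seq_borel"
      using \<phi> \<psi> by (intro unit_connective_compose_measurable[OF C] lipschitz_cylinderD(1))
    show "C (\<phi> x) (\<psi> x) \<in> {0..1}" for x
      using C range unfolding unit_connective_def by blast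
    fix x y :: "nat \<Rightarrow> real"
    have "\<bar>C (\<phi> x) (\<psi> x) - C (\<phi> y) (\<psi> y)\<bar> \<le> \<bar>\<phi> x - \<phi> y\<bar> + \<bar>\<psi> x - \<psi> y\<bar>"
      using C range unfolding unit_connective_def by blast
    also have "\<dots> \<le> L * (\<Sum>n<d. \<bar>x n - y n\<bar>) + K * (\<Sum>n<e. \<bar>x n - y n\<bar>)"
      by (intro add_mono L K)
    also have "\<dots> \<le> L * (\<Sum>n<max d e. \<bar>x n - y n\<bar>) + K * (\<Sum>n<max d e. \<bar>x n - y n\<bar>)"
      using L(1) K(1) by (intro add_mono mult_left_mono sum_mono2) auto
    finally show "\<bar>C (\<phi> x) (\<psi> x) - C (\<phi> y) (\<psi> y)\<bar> \<le> (L + K) * (\<Sum>n<max d e. \<bar>x n - y n\<bar>)"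
      by (simp add: algebra_simps)
  qed (use L(1) K(1) in auto)
qed

lemma abs_diff_le_one: "a \<in> {0..1} \<Longrightarrow> b \<in> {0..1} \<Longrightarrow> \<bar>a - b\<bar> \<le> (1::real)"
  by (simp add: abs_le_iff)

text \<open>As the slope \<open>k\<close> grows, the ramps increase to the indicator of \<open>x i > a\<close>.\<close>
lemma lipschitz_cylinder_ramp:
  assumes "0 \<le> k"
  shows "lipschitz_cylinder (\<lambda>x. max 0 (min 1 (k * (x i - a))))"
proof (rule lipschitz_cylinderI[where L=k and d="Suc i"])
  fix x y :: "nat \<Rightarrow> real"
  have "\<bar>max 0 (min 1 (k * (x i - a))) - max 0 (min 1 (k * (y i - a)))\<bar>
      \<le> \<bar>k * (x i - a) - k * (y i - a)\<bar>" by linarith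
  also have "\<dots> = k * \<bar>x i - y i\<bar>"
    using assms abs_mult[of k "x i - y i"] by (simp add: algebra_simps)
  also have "\<dots> \<le> k * (\<Sum>n<Suc i. \<bar>x n - y n\<bar>)"
    using assms by (intro mult_left_mono) (auto intro: sum_nonneg)
  finally show "\<bar>max 0 (min 1 (k * (x i - a))) - max 0 (min 1 (k * (y i - a)))\<bar>
      \<le> k * (\<Sum>n<Suc i. \<bar>x n - y n\<bar>)" .
qed (use assms in auto)

locale past_law = prob_space \<mu> for \<mu> :: "(nat \<Rightarrow> real) measure" +
  assumes sets_law [measurable_cong]: "sets \<mu> = sets seq_borel"
begin

lemma space_law [simp]: "space \<mu> = UNIV"
  using sets_eq_imp_space_eq[OF sets_law] by (simp add: space_PiM)

definition unit_fun :: "((nat \<Rightarrow> real) \<Rightarrow> real) \<Rightarrow> bool" where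
  "unit_fun f \<longleftrightarrow> f \<in> borel_measurable \<mu> \<and> (\<forall>x. f x \<in> {0..1})"

definition approximable :: "((nat \<Rightarrow> real) \<Rightarrow> real) \<Rightarrow> bool" where
  "approximable f \<longleftrightarrow> unit_fun f \<and>
     (\<forall>\<epsilon>>0. \<exists>\<phi>. lipschitz_cylinder \<phi> \<and> (\<integral>x. \<bar>f x - \<phi> x\<bar> \<partial>\<mu>) < \<epsilon>)"

lemma unit_funD [dest]: "unit_fun f \<Longrightarrow> f \<in> borel_measurable \<mu>"
  and unit_fun_range: "unit_fun f \<Longrightarrow> 0 \<le> f x" "unit_fun f \<Longrightarrow> f x \<le> 1"
  by (auto simp: unit_fun_def)

lemma lipschitz_cylinder_unit_fun: "lipschitz_cylinder \<phi> \<Longrightarrow> unit_fun \<phi>"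
  using lipschitz_cylinderD[of \<phi>] by (auto simp: unit_fun_def)

lemma integrable_unit_diff:
  assumes "unit_fun f" "unit_fun g"
  shows "integrable \<mu> (\<lambda>x. \<bar>f x - g x\<bar>)"
proof (rule integrable_const_bound[where B=1])
  note [measurable] = unit_funD[OF assms(1)] unit_funD[OF assms(2)]
  show "AE x in \<mu>. norm \<bar>f x - g x\<bar> \<le> 1"
    using assms unfolding unit_fun_def by (intro AE_I2) (simp add: abs_diff_le_one)
  show "(\<lambda>x. \<bar>f x - g x\<bar>) \<in> borel_measurable \<mu>" by measurable
qed

lemma approximable_lipschitz_cylinder: "lipschitz_cylinder \<phi> \<Longrightarrow> approximable \<phi>"
  using lipschitz_cylinder_unit_fun by (auto simp: approximable_def intro!: exI[of _ \<phi>])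

text \<open>The error of the combination is at most the sum of the two errors, by the Lipschitz property
  of the connective.\<close>
lemma approximable_combine:
  assumes C: "unit_connective C" and f: "approximable f" and g: "approximable g"
  shows "approximable (\<lambda>x. C (f x) (g x))"
  unfolding approximable_def
proof (intro conjI allI impI)
  have fg: "unit_fun f" "unit_fun g" using f g by (auto simp: approximable_def)
  have "(\<lambda>x. C (f x) (g x)) \<in> borel_measurable \<mu>"
    using fg by (intro unit_connective_compose_measurable[OF C] unit_funD)
  moreover have "C (f x) (g x) \<in> {0..1}" for x
    using C fg unfolding unit_connective_def unit_fun_def by blast
  ultimately show h: "unit_fun (\<lambda>x. C (f x) (g x))" unfolding unit_fun_def by blast
  fix \<epsilon> :: real assume "0 < \<epsilon>"
  obtain \<phi> where \<phi>: "lipschitz_cylinder \<phi>" "(\<integral>x. \<bar>f x - \<phi> x\<bar> \<partial>\<mu>) < \<epsilon> / 2"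
    using f \<open>0 < \<epsilon>\<close> half_gt_zero unfolding approximable_def by blast
  obtain \<psi> where \<psi>: "lipschitz_cylinder \<psi>" "(\<integral>x. \<bar>g x - \<psi> x\<bar> \<partial>\<mu>) < \<epsilon> / 2"
    using g \<open>0 < \<epsilon>\<close> half_gt_zero unfolding approximable_def by blast
  note unit = lipschitz_cylinder_unit_fun[OF \<phi>(1)] lipschitz_cylinder_unit_fun[OF \<psi>(1)]
    lipschitz_cylinder_unit_fun[OF lipschitz_cylinder_combine[OF C \<phi>(1) \<psi>(1)]]
  have "(\<integral>x. \<bar>C (f x) (g x) - C (\<phi> x) (\<psi> x)\<bar> \<partial>\<mu>) \<le> (\<integral>x. \<bar>f x - \<phi> x\<bar> + \<bar>g x - \<psi> x\<bar> \<partial>\<mu>)"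
  proof (intro integral_mono integrable_unit_diff Bochner_Integration.integrable_add h fg unit)
    fix x
    have "f x \<in> {0..1}" "g x \<in> {0..1}" "\<phi> x \<in> {0..1}" "\<psi> x \<in> {0..1}"
      using fg unit unfolding unit_fun_def by blast+
    with C show "\<bar>C (f x) (g x) - C (\<phi> x) (\<psi> x)\<bar> \<le> \<bar>f x - \<phi> x\<bar> + \<bar>g x - \<psi> x\<bar>"
      unfolding unit_connective_def by blast
  qed
  also have "\<dots> = (\<integral>x. \<bar>f x - \<phi> x\<bar> \<partial>\<mu>) + (\<integral>x. \<bar>g x - \<psi> x\<bar> \<partial>\<mu>)"
    using fg unit by (intro Bochner_Integration.integral_add integrable_unit_diff)
  also have "\<dots> < \<epsilon>" using \<phi>(2) \<psi>(2) by simp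
  finally show "\<exists>\<eta>. lipschitz_cylinder \<eta> \<and> (\<integral>x. \<bar>C (f x) (g x) - \<eta> x\<bar> \<partial>\<mu>) < \<epsilon>"
    using lipschitz_cylinder_combine[OF C \<phi>(1) \<psi>(1)] by blast
qed

lemma approximable_limit:
  assumes f: "\<And>n. approximable (f n)" and lim: "\<And>x. (\<lambda>n. f n x) \<longlonglongrightarrow> h x"
  shows "approximable h"
  unfolding approximable_def
proof (intro conjI allI impI)
  have unit: "unit_fun (f n)" for n using f by (auto simp: approximable_def)
  note [measurable] = unit_funD[OF unit]
  have range: "f n x \<in> {0..1}" for n x using unit by (auto simp: unit_fun_def)
  have [measurable]: "h \<in> borel_measurable \<mu>"
    by (rule borel_measurable_LIMSEQ_real[of _ f]) (auto intro: lim)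
  moreover have "h x \<in> {0..1}" for x
    using lim closed_sequentially[OF closed_atLeastAtMost, of "\<lambda>n. f n x"] range by blast
  ultimately show h: "unit_fun h" unfolding unit_fun_def by blast
  fix \<epsilon> :: real assume "0 < \<epsilon>"
  have "(\<lambda>n. \<integral>x. \<bar>h x - f n x\<bar> \<partial>\<mu>) \<longlonglongrightarrow> (\<integral>x. 0 \<partial>\<mu>)"
  proof (rule integral_dominated_convergence[where w="\<lambda>_. 1"])
    have "(\<lambda>n. \<bar>h x - f n x\<bar>) \<longlonglongrightarrow> 0" for x
      using tendsto_rabs[OF tendsto_diff[OF tendsto_const lim[of x]], of "h x"] by simp
    then show "AE x in \<mu>. (\<lambda>n. \<bar>h x - f n x\<bar>) \<longlonglongrightarrow> 0" by simp
    show "AE x in \<mu>. norm \<bar>h x - f n x\<bar> \<le> 1" for n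
      using range h unfolding unit_fun_def by (intro AE_I2) (simp add: abs_diff_le_one)
  qed auto
  then have "\<forall>\<^sub>F n in sequentially. (\<integral>x. \<bar>h x - f n x\<bar> \<partial>\<mu>) < \<epsilon> / 2"
    using \<open>0 < \<epsilon>\<close> by (intro order_tendstoD) auto
  then obtain n where n: "(\<integral>x. \<bar>h x - f n x\<bar> \<partial>\<mu>) < \<epsilon> / 2"
    by (auto simp: eventually_sequentially)
  obtain \<phi> where \<phi>: "lipschitz_cylinder \<phi>" "(\<integral>x. \<bar>f n x - \<phi> x\<bar> \<partial>\<mu>) < \<epsilon> / 2"
    using f[of n] \<open>0 < \<epsilon>\<close> half_gt_zero unfolding approximable_def by blast
  note \<phi>_unit = lipschitz_cylinder_unit_fun[OF \<phi>(1)]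
  have "(\<integral>x. \<bar>h x - \<phi> x\<bar> \<partial>\<mu>) \<le> (\<integral>x. \<bar>h x - f n x\<bar> + \<bar>f n x - \<phi> x\<bar> \<partial>\<mu>)"
    using h unit \<phi>_unit
    by (intro integral_mono Bochner_Integration.integrable_add integrable_unit_diff) auto
  also have "\<dots> = (\<integral>x. \<bar>h x - f n x\<bar> \<partial>\<mu>) + (\<integral>x. \<bar>f n x - \<phi> x\<bar> \<partial>\<mu>)"
    using h unit \<phi>_unit by (intro Bochner_Integration.integral_add integrable_unit_diff)
  also have "\<dots> < \<epsilon>" using n \<phi>(2) by simp
  finally show "\<exists>\<phi>. lipschitz_cylinder \<phi> \<and> (\<integral>x. \<bar>h x - \<phi> x\<bar> \<partial>\<mu>) < \<epsilon>" using \<phi>(1) by blast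
qed

lemma approximable_half_space: "approximable (indicator {x. a < x i})"
proof (rule approximable_limit)
  show "approximable (\<lambda>x. max 0 (min 1 (real n * (x i - a))))" for n
    by (intro approximable_lipschitz_cylinder lipschitz_cylinder_ramp) simp
  fix x :: "nat \<Rightarrow> real"
  show "(\<lambda>n. max 0 (min 1 (real n * (x i - a)))) \<longlonglongrightarrow> indicator {x. a < x i} x"
  proof (cases "a < x i")
    case True
    then obtain N where N: "1 < real N * (x i - a)"
      using reals_Archimedean3[of "x i - a"] by auto
    have "max 0 (min 1 (real n * (x i - a))) = indicator {x. a < x i} x" if "n \<ge> N" for n
    proof -
      have "real N * (x i - a) \<le> real n * (x i - a)" using that True by (intro mult_right_mono) auto
      then have "1 \<le> real n * (x i - a)" using N by linarith
      with True show ?thesis by simp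
    qed
    then show ?thesis by (intro tendsto_eventually) (auto simp: eventually_sequentially)
  next
    case False
    then have "real n * (x i - a) \<le> 0" for n by (intro mult_nonneg_nonpos) auto
    then have "max 0 (min 1 (real n * (x i - a))) = 0" for n by (meson max.absorb1 min.coboundedI2)
    with False show ?thesis by simp
  qed
qed

text \<open>The approximable sets form a \<open>\<sigma>\<close>-algebra that contains every half-space \<open>x i > a\<close>. All
  coordinates are measurable for it, hence so is the identity into the product \<open>\<sigma>\<close>-algebra; that
  is, every measurable set is approximable.\<close>
lemma approximable_indicator:
  assumes "A \<in> sets \<mu>"
  shows "approximable (indicator A)"
proof -
  define \<A> where "\<A> = {A. approximable (indicator A)}"
  have Int: "A \<inter> B \<in> \<A>" if "A \<in> \<A>" "B \<in> \<A>" for A B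
    using that approximable_combine[OF unit_connective_mult, of "indicator A" "indicator B"]
    unfolding \<A>_def by (simp add: indicator_inter_arith[symmetric])
  have Compl: "- A \<in> \<A>" if "A \<in> \<A>" for A
    using that approximable_combine[OF unit_connective_compl, of "indicator A" "indicator A"] unfolding \<A>_def
    by (simp add: indicator_compl[abs_def])
  have empty: "{} \<in> \<A>"
    using approximable_lipschitz_cylinder[OF lipschitz_cylinder_const[of 0]]
    unfolding \<A>_def by (simp add: indicator_def[abs_def])
  have UN: "(\<Union>n. A n) \<in> \<A>" if A: "\<And>n. A n \<in> \<A>" for A :: "nat \<Rightarrow> _"
  proof -
    have "(\<Union>i<n. A i) \<in> \<A>" for n
    proof (induction n)
      case (Suc n)
      have "(\<Union>i<Suc n. A i) = - (- (\<Union>i<n. A i) \<inter> - A n)" by (auto simp: lessThan_Suc)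
      then show ?case using Suc A Int Compl by metis
    qed (simp add: empty)
    moreover have "(\<lambda>n. indicator (\<Union>i<n. A i) x :: real) \<longlonglongrightarrow> indicator (\<Union>n. A n) x" for x
      by (rule LIMSEQ_indicator_UN)
    ultimately show ?thesis
      unfolding \<A>_def using approximable_limit[of "\<lambda>n. indicator (\<Union>i<n. A i)"] by simp
  qed
  have "algebra UNIV \<A>"
    unfolding algebra_iff_Int using Int Compl empty by (auto simp: Compl_eq_Diff_UNIV[symmetric])
  then have "sigma_algebra UNIV \<A>"
    unfolding sigma_algebra_iff using UN by (meson rangeI subsetD)
  then have sets: "sets (sigma UNIV \<A>) = \<A>"
    by (simp add: sigma_algebra.sigma_sets_eq)
  have "(\<lambda>x i. x i) \<in> sigma UNIV \<A> \<rightarrow>\<^sub>M seq_borel"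
  proof (rule measurable_PiM_single')
    fix i
    show "(\<lambda>x. x i) \<in> borel_measurable (sigma UNIV \<A>)"
      using approximable_half_space by (intro borel_measurableI_greater) (simp add: sets \<A>_def)
  qed auto
  from measurable_sets[OF this, of A] assms show ?thesis
    by (simp add: sets sets_law) (simp add: \<A>_def)
qed

lemma approximable_average:
  assumes "\<And>j. approximable (f j)" "0 < k"
  shows "approximable (\<lambda>x. (\<Sum>j<k. f j x) / real k)"
  using \<open>0 < k\<close>
proof (induction k rule: nat_induct_non_zero)
  case 1
  then show ?case using assms by simp
next
  case (Suc k)
  have "(\<Sum>j<Suc k. f j x) / real (Suc k)
     = (1 / real (Suc k)) * f k x + (1 - 1 / real (Suc k)) * ((\<Sum>j<k. f j x) / real k)" for x
  proof -
    have "1 - 1 / real (Suc k) = real k / real (Suc k)" by (simp add: field_simps)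
    with Suc.hyps show ?thesis by (simp add: add_divide_distrib)
  qed
  then show ?case
    using approximable_combine[OF unit_connective_convex assms(1)[of k] Suc.IH, of "1 / real (Suc k)"] by simp
qed

text \<open>A function with values in \<open>[0,1]\<close> is the limit of its roundings \<open>\<lfloor>k f\<rfloor> / k\<close>, and such a rounding is
  the average of the indicators of \<open>f \<ge> j / k\<close> for \<open>j = 1, \<dots>, k\<close>.\<close>
lemma approximable_unit_fun:
  assumes f: "unit_fun f"
  shows "approximable f"
proof (rule approximable_limit)
  note [measurable] = unit_funD[OF f]
  define q where "q k x = (\<Sum>j<k. indicator {x. real (Suc j) \<le> real k * f x} x) / real k" for k x
  have floor: "q k x = of_int \<lfloor>real k * f x\<rfloor> / real k" for k x
  proof -
    have r: "0 \<le> real k * f x" "real k * f x \<le> real k"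
      using unit_fun_range[OF f, of x] by (auto intro: mult_left_le)
    have "j < k \<and> real (Suc j) \<le> real k * f x \<longleftrightarrow> j < nat \<lfloor>real k * f x\<rfloor>" for j
    proof -
      have "real (Suc j) \<le> real k * f x \<longleftrightarrow> int (Suc j) \<le> \<lfloor>real k * f x\<rfloor>" by (simp add: le_floor_iff)
      moreover have "\<lfloor>real k * f x\<rfloor> \<le> int k" using r(2) by (simp add: floor_le_iff)
      ultimately show ?thesis by linarith
    qed
    then have "{..<k} \<inter> {j. real (Suc j) \<le> real k * f x} = {..<nat \<lfloor>real k * f x\<rfloor>}" by auto
    then have "(\<Sum>j<k. indicator {x. real (Suc j) \<le> real k * f x} x) = real (nat \<lfloor>real k * f x\<rfloor>)"
      by (simp add: indicator_def sum.If_cases)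
    with r show ?thesis by (simp add: q_def)
  qed
  show "approximable (q (Suc k))" for k
  proof -
    have "{x \<in> space \<mu>. real (Suc j) \<le> real (Suc k) * f x} \<in> sets \<mu>" for j by measurable
    then show ?thesis
      unfolding q_def by (intro approximable_average approximable_indicator) simp_all
  qed
  show "(\<lambda>k. q (Suc k) x) \<longlonglongrightarrow> f x" for x
  proof (rule real_tendsto_sandwich)
    have "f x - 1 / real (Suc k) \<le> q (Suc k) x \<and> q (Suc k) x \<le> f x" for k
    proof -
      have "real (Suc k) * f x - 1 \<le> real_of_int \<lfloor>real (Suc k) * f x\<rfloor>"
        "real_of_int \<lfloor>real (Suc k) * f x\<rfloor> \<le> real (Suc k) * f x" by linarith+
      then have "(real (Suc k) * f x - 1) / real (Suc k) \<le> q (Suc k) x"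
        "q (Suc k) x \<le> real (Suc k) * f x / real (Suc k)"
        unfolding floor by (intro divide_right_mono; simp del: of_nat_Suc)+
      then show ?thesis by (simp add: diff_divide_distrib del: of_nat_Suc)
    qed
    then show "\<forall>\<^sub>F k in sequentially. f x - 1 / real (Suc k) \<le> q (Suc k) x"
      "\<forall>\<^sub>F k in sequentially. q (Suc k) x \<le> f x" by auto
    show "(\<lambda>k. f x - 1 / real (Suc k)) \<longlonglongrightarrow> f x"
      using LIMSEQ_inverse_real_of_nat_add_minus[of "f x"] by (simp add: inverse_eq_divide)
  qed simp
qed

end

text \<open>A window lists its observations forwards in time, whereas the infinite past is indexed
  backwards, so the coordinates are reversed. A coordinate of the \<open>\<ell>\<^sup>1\<close> distance is at most the Euclidean
  distance, which gives the constant \<open>L * e\<close>.\<close>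
lemma lipschitz_cylinder_window:
  assumes "lipschitz_cylinder \<phi>"
  obtains d L h where "1 \<le> d" "0 \<le> L" "h \<in> lipschitz_class L d"
    and "\<And>Y t \<omega>. h (window Y (t - int d) d \<omega>) = \<phi> (\<lambda>k. Y (t - 1 - int k) \<omega>)"
proof -
  obtain e L where L: "0 \<le> L" "\<And>x y. \<bar>\<phi> x - \<phi> y\<bar> \<le> L * (\<Sum>n<e. \<bar>x n - y n\<bar>)"
    using assms unfolding lipschitz_cylinder_def by blast
  \<comment> \<open>One more than the number of relevant coordinates, so that the window is nonempty.\<close>
  define d where "d = Suc e"
  define h where "h w = \<phi> (\<lambda>n. w (d - Suc n))" for w :: "nat \<Rightarrow> real"
  have "h \<in> lipschitz_class (L * real e) d"
    unfolding lipschitz_class_def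
  proof (intro CollectI conjI ballI funcsetI)
    show "h x \<in> {0..1}" for x using lipschitz_cylinderD(2,3)[OF assms] by (auto simp: h_def)
    fix x y
    have "\<bar>h x - h y\<bar> \<le> L * (\<Sum>n<e. \<bar>x (d - Suc n) - y (d - Suc n)\<bar>)"
      unfolding h_def by (rule L(2))
    also have "\<dots> \<le> L * (\<Sum>n<e. L2_set (\<lambda>i. x i - y i) {..<d})"
    proof (intro mult_left_mono sum_mono L(1))
      fix n assume "n \<in> {..<e}"
      then show "\<bar>x (d - Suc n) - y (d - Suc n)\<bar> \<le> L2_set (\<lambda>i. x i - y i) {..<d}"
        using member_le_L2_set[of "{..<d}" "d - Suc n" "\<lambda>i. \<bar>x i - y i\<bar>"]
        by (simp add: d_def L2_set_def)
    qed
    finally show "\<bar>h x - h y\<bar> \<le> L * real e * L2_set (\<lambda>i. x i - y i) {..<d}" by simp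
  qed
  moreover have "h (window Y (t - int d) d \<omega>) = \<phi> (\<lambda>k. Y (t - 1 - int k) \<omega>)" for Y t \<omega>
  proof -
    have "\<bar>h (window Y (t - int d) d \<omega>) - \<phi> (\<lambda>k. Y (t - 1 - int k) \<omega>)\<bar> \<le> L * (\<Sum>n<e. 0)"
      unfolding h_def
      by (rule order_trans[OF L(2)], intro mult_left_mono sum_mono L(1))
         (auto simp: window_def d_def of_nat_diff algebra_simps)
    then show ?thesis by simp
  qed
  ultimately show ?thesis using that[of d "L * real e" h] L(1) by (auto simp: d_def)
qed

section \<open>Predictors and their conditional losses\<close>

text \<open>The pointwise operation that turns a process into its version with values in \<open>[0,1]\<close>.\<close>
definition clip :: "real \<Rightarrow> real" where
  "clip z = (if z \<in> {0..1} then z else 0)"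

lemma clip_measurable [measurable]: "clip \<in> borel \<rightarrow>\<^sub>M unit_borel"
  unfolding clip_def[abs_def] by (intro measurable_restrict_space2) auto

lemma clip_range: "0 \<le> clip z" "clip z \<le> 1"
  by (auto simp: clip_def)

lemma unit_version_clip: "unit_version Y t \<omega> = clip (Y t \<omega>)"
  by (simp add: unit_version_def clip_def)

lemma past_unit_version: "past (unit_version Y) \<omega> = (\<lambda>n. clip (past Y \<omega> n))"
  by (simp add: past_def unit_version_clip)

lemma zero_borel_predictor: "(\<lambda>_. 0) \<in> borel_predictors"
  unfolding borel_predictors_def by (intro measurable_restrict_space2) auto

lemma borel_predictor_clip:
  assumes "f \<in> borel_predictors"
  shows "(\<lambda>x. f (\<lambda>n. clip (x n))) \<in> seq_borel \<rightarrow>\<^sub>M unit_borel"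
proof -
  have "(\<lambda>x n. clip (x n)) \<in> seq_borel \<rightarrow>\<^sub>M Pi\<^sub>M UNIV (\<lambda>_. unit_borel)"
    by (rule measurable_PiM_single') (auto simp: clip_range)
  from measurable_compose[OF this] assms show ?thesis unfolding borel_predictors_def by blast
qed

text \<open>The choice between two predictors may depend on the past. This is what makes the family of
  conditional losses directed.\<close>
lemma borel_predictor_switch:
  assumes f: "f \<in> borel_predictors" and g: "g \<in> borel_predictors" and B: "B \<in> sets seq_borel"
  shows "(\<lambda>x. if x \<in> B then f x else g x) \<in> borel_predictors"
  unfolding borel_predictors_def
proof (rule measurable_If_set)
  let ?N = "Pi\<^sub>M UNIV (\<lambda>_. unit_borel) :: (nat \<Rightarrow> real) measure"
  \<comment> \<open>The event \<open>B\<close> refers to all real sequences; it is pulled back along the inclusion of \<open>[0,1]\<^sup>\<nat>\<close>.\<close>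
  have "(\<lambda>x n. x n) \<in> ?N \<rightarrow>\<^sub>M seq_borel"
  proof (rule measurable_PiM_single')
    show "(\<lambda>x. x i) \<in> ?N \<rightarrow>\<^sub>M borel" for i
      using measurable_component_singleton[of i UNIV "\<lambda>_. unit_borel"]
      by (simp add: measurable_restrict_space2_iff)
  qed auto
  from measurable_sets[OF this B] show "B \<inter> space ?N \<in> sets ?N" by simp
qed (use f g in \<open>auto simp: borel_predictors_def\<close>)

locale bounded_loss_process = prob_space P for P :: "'a measure" +
  fixes Y :: "int \<Rightarrow> 'a \<Rightarrow> real" and loss :: "real \<Rightarrow> real \<Rightarrow> real" and M :: real
  assumes Y_measurable [measurable]: "\<And>t. Y t \<in> borel_measurable P"
    and Y_unit: "\<And>t. AE \<omega> in P. Y t \<omega> \<in> {0..1}"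
    and loss_range: "\<And>x y. x \<in> {0..1} \<Longrightarrow> y \<in> {0..1} \<Longrightarrow> loss x y \<in> {0..1}"
    and loss_measurable: "(\<lambda>(x, y). loss x y) \<in> borel_measurable (restrict_space borel ({0..1} \<times> {0..1}))"
    and loss_lipschitz: "\<And>y. y \<in> {0..1} \<Longrightarrow> M-lipschitz_on {0..1} (\<lambda>x. loss x y)"
begin

lemma loss_compose_measurable:
  assumes a: "a \<in> N \<rightarrow>\<^sub>M unit_borel" and b: "b \<in> N \<rightarrow>\<^sub>M unit_borel"
  shows "(\<lambda>z. loss (a z) (b z)) \<in> borel_measurable N"
proof -
  have [measurable]: "a \<in> borel_measurable N" "b \<in> borel_measurable N"
    using a b by (auto simp: measurable_restrict_space2_iff)
  have "(\<lambda>z. (a z, b z)) \<in> N \<rightarrow>\<^sub>M restrict_space borel ({0..1} \<times> {0..1})"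
    using measurable_space[OF a] measurable_space[OF b]
    by (intro measurable_restrict_space2) auto
  from measurable_compose[OF this loss_measurable] show ?thesis by simp
qed

lemma past_measurable [measurable]: "past Y \<in> P \<rightarrow>\<^sub>M seq_borel"
  unfolding past_def[abs_def] by (rule measurable_PiM_single') auto

lemma AE_unit: "AE \<omega> in P. \<forall>t. Y t \<omega> \<in> {0..1}"
  using Y_unit by (simp add: AE_all_countable)

lemma past_subalgebra: "subalgebra P (past_algebra P Y)"
  unfolding subalgebra_def past_algebra_def
  using measurable_sets[OF past_measurable]
  by (auto simp: sets_vimage_algebra2 space_PiM)

sublocale past: finite_measure_subalgebra P "past_algebra P Y"
  by unfold_locales (rule past_subalgebra)

definition predictor_loss :: "((nat \<Rightarrow> real) \<Rightarrow> real) \<Rightarrow> 'a \<Rightarrow> real" where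
  "predictor_loss f \<omega> = loss (f (past (unit_version Y) \<omega>)) (unit_version Y 0 \<omega>)"

abbreviation conditional_loss :: "((nat \<Rightarrow> real) \<Rightarrow> real) \<Rightarrow> 'a \<Rightarrow> real" where
  "conditional_loss f \<equiv> real_cond_exp P (past_algebra P Y) (predictor_loss f)"

lemma predictor_loss_range:
  assumes "f \<in> borel_predictors"
  shows "predictor_loss f \<omega> \<in> {0..1}"
  using measurable_space[OF borel_predictor_clip[OF assms], of "past Y \<omega>"]
  unfolding predictor_loss_def unit_version_clip past_unit_version
  by (intro loss_range) (auto simp: space_PiM clip_range)

lemma predictor_loss_measurable:
  assumes "f \<in> borel_predictors"
  shows "predictor_loss f \<in> borel_measurable P"
  unfolding predictor_loss_def[abs_def] unit_version_clip past_unit_version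
  using measurable_compose[OF past_measurable borel_predictor_clip[OF assms]]
  by (intro loss_compose_measurable) auto

lemma predictor_loss_integrable:
  assumes "f \<in> borel_predictors"
  shows "integrable P (predictor_loss f)"
  using predictor_loss_range[OF assms] predictor_loss_measurable[OF assms]
  by (intro integrable_const_bound[where B=1] AE_I2) auto

text \<open>Given two predictors, follow the one whose conditional loss is smaller. The event \<open>A\<close> on which
  this is the first one belongs to the \<open>\<sigma>\<close>-algebra of the past, so its indicator can be taken out
  of the conditional expectation, and the conditional loss of the switching predictor is the
  minimum of the two.\<close>
lemma conditional_loss_directed:
  "directed_below P conditional_loss borel_predictors"
  unfolding directed_below_def
proof (intro ballI)
  fix f g assume f: "f \<in> borel_predictors" and g: "g \<in> borel_predictors"
  let ?F = "past_algebra P Y"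
  note [measurable] = predictor_loss_measurable[OF f] predictor_loss_measurable[OF g]
  define A where "A = {\<omega> \<in> space ?F. conditional_loss f \<omega> \<le> conditional_loss g \<omega>}"
  have A [measurable]: "A \<in> sets ?F" unfolding A_def by measurable
  then obtain B where B: "B \<in> sets seq_borel" "A = past Y -` B \<inter> space P"
    unfolding past_algebra_def by (auto simp: sets_vimage_algebra2 space_PiM)
  have AP [measurable]: "A \<in> sets P" using B past_measurable by (auto intro: measurable_sets)
  define h where "h x = (if x \<in> B then f x else g x)" for x
  have h: "h \<in> borel_predictors" unfolding h_def by (rule borel_predictor_switch[OF f g B(1)])
  note [measurable] = predictor_loss_measurable[OF h]
  let ?a = "\<lambda>\<omega>. indicator A \<omega> :: real"
  have int: "integrable P (\<lambda>\<omega>. ?a \<omega> * predictor_loss f \<omega>)"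
    "integrable P (\<lambda>\<omega>. (1 - ?a \<omega>) * predictor_loss g \<omega>)"
    using predictor_loss_range[OF f] predictor_loss_range[OF g]
    by (intro integrable_const_bound[where B=1] AE_I2; auto simp: indicator_def)+
  \<comment> \<open>The event \<open>B\<close> was found for the past of \<open>Y\<close>, but predictors see the past of the version with
    values in \<open>[0,1]\<close>; the two agree only almost surely.\<close>
  have "AE \<omega> in P. predictor_loss h \<omega>
      = ?a \<omega> * predictor_loss f \<omega> + (1 - ?a \<omega>) * predictor_loss g \<omega>"
    using AE_unit AE_space
  proof eventually_elim
    case (elim \<omega>)
    then have "past (unit_version Y) \<omega> = past Y \<omega>"
      by (auto simp: past_def unit_version_def)
    with elim show ?case by (auto simp: predictor_loss_def h_def B(2) indicator_def)
  qed
  then have "AE \<omega> in P. conditional_loss h \<omega> = real_cond_exp P ?F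
      (\<lambda>\<omega>. ?a \<omega> * predictor_loss f \<omega> + (1 - ?a \<omega>) * predictor_loss g \<omega>) \<omega>"
    by (rule past.real_cond_exp_cong) auto
  moreover have "AE \<omega> in P. real_cond_exp P ?F
      (\<lambda>\<omega>. ?a \<omega> * predictor_loss f \<omega> + (1 - ?a \<omega>) * predictor_loss g \<omega>) \<omega>
      = real_cond_exp P ?F (\<lambda>\<omega>. ?a \<omega> * predictor_loss f \<omega>) \<omega>
        + real_cond_exp P ?F (\<lambda>\<omega>. (1 - ?a \<omega>) * predictor_loss g \<omega>) \<omega>"
    by (rule past.real_cond_exp_add[OF int])
  moreover have "AE \<omega> in P. real_cond_exp P ?F (\<lambda>\<omega>. ?a \<omega> * predictor_loss f \<omega>) \<omega>
      = ?a \<omega> * conditional_loss f \<omega>"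
    by (rule past.real_cond_exp_mult[OF _ _ int(1)]) auto
  moreover have "AE \<omega> in P. real_cond_exp P ?F (\<lambda>\<omega>. (1 - ?a \<omega>) * predictor_loss g \<omega>) \<omega>
      = (1 - ?a \<omega>) * conditional_loss g \<omega>"
    by (rule past.real_cond_exp_mult[OF _ _ int(2)]) auto
  ultimately have "AE \<omega> in P. conditional_loss h \<omega> \<le> min (conditional_loss f \<omega>) (conditional_loss g \<omega>)"
    using AE_space
  proof eventually_elim
    case (elim \<omega>)
    have "\<omega> \<in> space ?F" using elim by (simp add: past_algebra_def)
    with elim show ?case by (auto simp: A_def indicator_def)
  qed
  with h show "\<exists>h\<in>borel_predictors. AE \<omega> in P.
      conditional_loss h \<omega> \<le> min (conditional_loss f \<omega>) (conditional_loss g \<omega>)" by blast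
qed

text \<open>Since the conditional losses are directed, the integral of their essential infimum is the
  infimum of their integrals, and conditioning does not change an integral.\<close>
lemma L_star_eq_INF: "L_star P loss Y = (INF f\<in>borel_predictors. \<integral>\<omega>. predictor_loss f \<omega> \<partial>P)"
proof -
  have "borel_predictors \<noteq> {}" using zero_borel_predictor by blast
  then have "L_star P loss Y = (INF f\<in>borel_predictors. \<integral>\<omega>. conditional_loss f \<omega> \<partial>P)"
    unfolding L_star_def predictor_loss_def[symmetric, abs_def]
    using predictor_loss_range predictor_loss_measurable predictor_loss_integrable
    by (intro integral_essential_infimum_directed conditional_loss_directed
          past.real_cond_exp_int past.real_cond_exp_pos) auto
  then show ?thesis using past.real_cond_exp_int(2)[OF predictor_loss_integrable] by simp
qed

text \<open>Some predictor \<open>f\<close> has expected loss below \<open>c\<close>. Replacing \<open>f\<close> by a Lipschitz cylinder function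
  that is \<open>\<epsilon>\<close>-close to it in \<open>L\<^sup>1\<close> changes the expected loss by at most a multiple of \<open>\<epsilon>\<close>, because the
  loss is Lipschitz in its first argument.\<close>
lemma cylinder_loss_less:
  assumes "L_star P loss Y < c"
  obtains \<phi> where "lipschitz_cylinder \<phi>"
    and "(\<integral>\<omega>. loss (\<phi> (past Y \<omega>)) (clip (Y 0 \<omega>)) \<partial>P) < c"
proof -
  have "borel_predictors \<noteq> {}" using zero_borel_predictor by blast
  moreover have "bdd_below ((\<lambda>f. \<integral>\<omega>. predictor_loss f \<omega> \<partial>P) ` borel_predictors)"
    using predictor_loss_range by (intro bdd_belowI2[where m=0] integral_nonneg_AE) auto
  ultimately obtain f where f: "f \<in> borel_predictors" and less: "(\<integral>\<omega>. predictor_loss f \<omega> \<partial>P) < c"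
    using assms unfolding L_star_eq_INF by (auto simp: cInf_less_iff)
  define f' where "f' x = f (\<lambda>n. clip (x n))" for x
  have f'_pred: "f' \<in> seq_borel \<rightarrow>\<^sub>M unit_borel"
    unfolding f'_def by (rule borel_predictor_clip[OF f])
  then have f'_meas [measurable]: "f' \<in> borel_measurable seq_borel"
    by (auto simp: measurable_restrict_space2_iff)
  have f'_range: "f' x \<in> {0..1}" for x
    using measurable_space[OF f'_pred, of x] by (auto simp: space_PiM)
  interpret law: past_law "distr P seq_borel (past Y)"
    by (intro past_law.intro prob_space_distr past_law_axioms.intro) auto
  define K where "K = \<bar>M\<bar> + 1"
  have K: "0 < K" "M \<le> K" by (auto simp: K_def)
  \<comment> \<open>An \<open>L\<^sup>1\<close> error below \<open>\<epsilon>\<close> changes the loss by less than \<open>K * \<epsilon>\<close>, which is the gap up to \<open>c\<close>.\<close>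
  define \<epsilon> where "\<epsilon> = (c - (\<integral>\<omega>. predictor_loss f \<omega> \<partial>P)) / K"
  have "0 < \<epsilon>" using less K by (simp add: \<epsilon>_def)
  have "law.unit_fun f'" using f'_range by (simp add: law.unit_fun_def)
  then obtain \<phi> where \<phi>: "lipschitz_cylinder \<phi>"
    and close: "(\<integral>x. \<bar>f' x - \<phi> x\<bar> \<partial>distr P seq_borel (past Y)) < \<epsilon>"
    using law.approximable_unit_fun \<open>0 < \<epsilon>\<close> unfolding law.approximable_def by blast
  note [measurable] = lipschitz_cylinderD(1)[OF \<phi>]
  have \<phi>_range: "\<phi> x \<in> {0..1}" for x using lipschitz_cylinderD(2,3)[OF \<phi>] by auto
  let ?d = "\<lambda>\<omega>. \<bar>f' (past Y \<omega>) - \<phi> (past Y \<omega>)\<bar>"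
  let ?l = "\<lambda>\<omega>. loss (\<phi> (past Y \<omega>)) (clip (Y 0 \<omega>))"
  have "(\<integral>\<omega>. ?d \<omega> \<partial>P) < \<epsilon>" using close by (subst (asm) integral_distr) auto
  have d_int: "integrable P ?d"
  proof (rule integrable_const_bound[where B=1])
    show "AE \<omega> in P. norm (?d \<omega>) \<le> 1"
    proof (rule AE_I2)
      fix \<omega> show "norm (?d \<omega>) \<le> 1"
        using f'_range[of "past Y \<omega>"] \<phi>_range[of "past Y \<omega>"] by (simp add: abs_diff_le_one)
    qed
  qed measurable
  have "\<phi> \<in> seq_borel \<rightarrow>\<^sub>M unit_borel" using \<phi>_range by (intro measurable_restrict_space2) auto
  from measurable_compose[OF past_measurable this]
  have l_meas: "?l \<in> borel_measurable P" by (intro loss_compose_measurable) auto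
  have l_int: "integrable P ?l"
    using loss_range[OF \<phi>_range, of "clip _"] l_meas clip_range
    by (intro integrable_const_bound[where B=1] AE_I2) auto
  have bound: "?l \<omega> \<le> predictor_loss f \<omega> + K * ?d \<omega>" for \<omega>
  proof -
    have "\<bar>loss (\<phi> (past Y \<omega>)) (clip (Y 0 \<omega>)) - loss (f' (past Y \<omega>)) (clip (Y 0 \<omega>))\<bar> \<le> M * ?d \<omega>"
      using lipschitz_onD[OF loss_lipschitz, OF _ \<phi>_range f'_range, of "clip (Y 0 \<omega>)"] clip_range
      by (auto simp: dist_real_def abs_minus_commute)
    moreover have "M * ?d \<omega> \<le> K * ?d \<omega>" by (intro mult_right_mono K) auto
    moreover have "predictor_loss f \<omega> = loss (f' (past Y \<omega>)) (clip (Y 0 \<omega>))"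
      by (simp add: predictor_loss_def f'_def past_unit_version unit_version_clip)
    ultimately show ?thesis by linarith
  qed
  have "(\<integral>\<omega>. ?l \<omega> \<partial>P) \<le> (\<integral>\<omega>. predictor_loss f \<omega> + K * ?d \<omega> \<partial>P)"
    using d_int l_int predictor_loss_integrable[OF f] by (intro integral_mono bound) auto
  also have "\<dots> = (\<integral>\<omega>. predictor_loss f \<omega> \<partial>P) + K * (\<integral>\<omega>. ?d \<omega> \<partial>P)"
    using d_int predictor_loss_integrable[OF f] by simp
  also have "\<dots> < (\<integral>\<omega>. predictor_loss f \<omega> \<partial>P) + K * \<epsilon>"
    using \<open>(\<integral>\<omega>. ?d \<omega> \<partial>P) < \<epsilon>\<close> K by simp
  also have "\<dots> = c" using K by (simp add: \<epsilon>_def)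
  finally show ?thesis using that \<phi> by blast
qed

text \<open>The loss at time \<open>t\<close> is a function of the path shifted by \<open>t\<close>. The upper ergodic bound therefore
  applies to the shift on the space of paths with the law of the process.\<close>
lemma limsup_cylinder_loss_le:
  assumes "stationary P Y" "ergodic P Y" and \<phi>: "lipschitz_cylinder \<phi>"
    and less: "(\<integral>\<omega>. loss (\<phi> (past Y \<omega>)) (clip (Y 0 \<omega>)) \<partial>P) < c"
  shows "AE \<omega> in P. limsup (\<lambda>n. ereal (1 / real n *
     (\<Sum>t=1..n. loss (\<phi> (\<lambda>k. Y (int t - 1 - int k) \<omega>)) (clip (Y (int t) \<omega>))))) \<le> ereal c"
proof -
  let ?\<Pi> = "Pi\<^sub>M UNIV (\<lambda>_. borel) :: (int \<Rightarrow> real) measure"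
  let ?path = "\<lambda>\<omega> t. Y t \<omega>"
  define N where "N = distr P ?\<Pi> ?path"
  define S :: "(int \<Rightarrow> real) \<Rightarrow> int \<Rightarrow> real" where "S y = (\<lambda>t. y (t + 1))" for y
  define F where "F y = loss (\<phi> (\<lambda>k. y (- 1 - int k))) (clip (y 0))" for y
  have path [measurable]: "?path \<in> P \<rightarrow>\<^sub>M ?\<Pi>" by (rule measurable_PiM_single') auto
  have S [measurable]: "S \<in> ?\<Pi> \<rightarrow>\<^sub>M ?\<Pi>"
    unfolding S_def by (rule measurable_PiM_single') auto
  have \<phi>_unit: "\<phi> \<in> seq_borel \<rightarrow>\<^sub>M unit_borel"
    using lipschitz_cylinderD[OF \<phi>] by (intro measurable_restrict_space2) auto
  have "(\<lambda>y k. y (- 1 - int k)) \<in> ?\<Pi> \<rightarrow>\<^sub>M seq_borel" by (rule measurable_PiM_single') auto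
  from measurable_compose[OF this \<phi>_unit]
  have F [measurable]: "F \<in> borel_measurable ?\<Pi>"
    unfolding F_def[abs_def] by (intro loss_compose_measurable) auto
  have N_sets [measurable_cong, simp]: "sets N = sets ?\<Pi>" by (simp add: N_def)
  have "AE y in N. limsup (\<lambda>n. ereal (1 / real n * (\<Sum>t=1..n. F ((S ^^ t) y)))) \<le> ereal c"
  proof (rule limsup_birkhoff_average_le[where B=1])
    show "prob_space N" unfolding N_def by (rule prob_space_distr) simp
    show "S \<in> N \<rightarrow>\<^sub>M N" by measurable
    have "distr N N S = distr P ?\<Pi> (S \<circ> ?path)"
      unfolding N_def by (subst distr_distr[symmetric]) (auto intro: distr_cong)
    also have "\<dots> = N"
      using assms(1) unfolding stationary_def N_def S_def comp_def by blast
    finally show "distr N N S = N" .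
    show "measure N A \<in> {0, 1}" if "A \<in> sets N" "S -` A \<inter> space N = A" for A
    proof -
      have "(\<lambda>y t. y (t + 1)) -` A = A" using that(2) by (simp add: N_def space_PiM S_def[abs_def])
      with assms(2) that(1) have "measure P {\<omega> \<in> space P. ?path \<omega> \<in> A} \<in> {0, 1}"
        unfolding ergodic_def by simp
      moreover have "measure N A = measure P {\<omega> \<in> space P. ?path \<omega> \<in> A}"
        using that(1) unfolding N_def by (subst measure_distr) (auto intro: arg_cong[where f="measure P"])
      ultimately show ?thesis by simp
    qed
    show "F \<in> borel_measurable N" by measurable
    show "\<bar>F y\<bar> \<le> 1" for y
      using loss_range[of "\<phi> _" "clip (y 0)"] lipschitz_cylinderD(2,3)[OF \<phi>] clip_range[of "y 0"]
      by (auto simp: F_def)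
    show "(\<integral>y. F y \<partial>N) < c"
      using less unfolding N_def by (subst integral_distr) (auto simp: F_def past_def)
  qed
  then have "AE \<omega> in P. limsup (\<lambda>n. ereal (1 / real n * (\<Sum>t=1..n. F ((S ^^ t) (?path \<omega>))))) \<le> ereal c"
    unfolding N_def by (rule AE_distrD[OF path])
  moreover have "(S ^^ n) y = (\<lambda>t. y (t + int n))" for n y
    by (induction n) (auto simp: S_def algebra_simps)
  then have "F ((S ^^ t) (?path \<omega>)) = loss (\<phi> (\<lambda>k. Y (int t - 1 - int k) \<omega>)) (clip (Y (int t) \<omega>))" for t \<omega>
    by (simp add: F_def algebra_simps)
  ultimately show ?thesis by simp
qed

end

section \<open>Comparison of the strategy with the optimal loss\<close>

theorem theorem3:
  fixes P :: "'a measure" and Y :: "int \<Rightarrow> 'a \<Rightarrow> real"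
    and loss :: "real \<Rightarrow> real \<Rightarrow> real" and M :: real
    and g :: "nat \<Rightarrow> (nat \<Rightarrow> real) \<Rightarrow> real"
  assumes "prob_space P"
    and "\<And>t. Y t \<in> borel_measurable P"
    and "stationary P Y"
    and "ergodic P Y"
    and "\<And>t. AE \<omega> in P. Y t \<omega> \<in> {0..1}"
    and "\<And>d. d \<ge> 1 \<Longrightarrow>
          regular_law d (distr P (Pi\<^sub>M {..<d} (\<lambda>_. borel)) (window Y (- int d) d))"
    and "M > 0"
    and "\<And>x y. x \<in> {0..1} \<Longrightarrow> y \<in> {0..1} \<Longrightarrow> loss x y \<in> {0..1}"
    and "(\<lambda>(x, y). loss x y) \<in> borel_measurable (restrict_space borel ({0..1} \<times> {0..1}))"
    and "\<And>y. y \<in> {0..1} \<Longrightarrow> M-lipschitz_on {0..1} (\<lambda>x. loss x y)"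
    and "prediction_strategy g"
    and "\<And>d L. d \<ge> 1 \<Longrightarrow> L \<ge> 0 \<Longrightarrow> AE \<omega> in P.
          limsup (\<lambda>T. ereal (1 / real T * (\<Sum>t=1..T. loss (prediction g Y t \<omega>) (Y (int t) \<omega>))))
          \<le> limsup (\<lambda>T. INF f\<in>lipschitz_class L d.
               ereal (1 / real T * (\<Sum>t=1..T. loss (f (window Y (int t - int d) d \<omega>)) (Y (int t) \<omega>))))"
  shows "AE \<omega> in P.
          limsup (\<lambda>T. ereal (1 / real T * (\<Sum>t=1..T. loss (prediction g Y t \<omega>) (Y (int t) \<omega>))))
          \<le> ereal (L_star P loss Y)"
proof -
  interpret bounded_loss_process P Y loss M
    by (intro bounded_loss_process.intro bounded_loss_process_axioms.intro) (fact assms)+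
  let ?average_loss = "\<lambda>\<omega>. limsup (\<lambda>T. ereal (1 / real T * (\<Sum>t=1..T. loss (prediction g Y t \<omega>) (Y (int t) \<omega>))))"
  have "AE \<omega> in P. ?average_loss \<omega> \<le> ereal c" if less: "L_star P loss Y < c" for c
  proof -
    obtain \<phi> where \<phi>: "lipschitz_cylinder \<phi>"
      "(\<integral>\<omega>. loss (\<phi> (past Y \<omega>)) (clip (Y 0 \<omega>)) \<partial>P) < c"
      using cylinder_loss_less[OF less] by blast
    obtain d L h where dL: "1 \<le> d" "0 \<le> L" and h: "h \<in> lipschitz_class L d"
      and h_window: "\<And>t \<omega>. h (window Y (t - int d) d \<omega>) = \<phi> (\<lambda>k. Y (t - 1 - int k) \<omega>)"
      using lipschitz_cylinder_window[OF \<phi>(1)] by metis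
    show ?thesis
      using limsup_cylinder_loss_le[OF assms(3,4) \<phi>] assms(12)[OF dL] AE_unit
    proof eventually_elim
      case (elim \<omega>)
      note elim(2)
      also have "limsup (\<lambda>T. INF f\<in>lipschitz_class L d.
            ereal (1 / real T * (\<Sum>t=1..T. loss (f (window Y (int t - int d) d \<omega>)) (Y (int t) \<omega>))))
          \<le> limsup (\<lambda>T. ereal (1 / real T *
              (\<Sum>t=1..T. loss (h (window Y (int t - int d) d \<omega>)) (Y (int t) \<omega>))))"
        by (intro Limsup_mono always_eventually allI INF_lower h)
      also have "\<dots> \<le> ereal c"
        using elim(1,3) by (simp add: h_window clip_def)
      finally show ?case .
    qed
  qed
  then have "AE \<omega> in P. \<forall>n. ?average_loss \<omega> \<le> ereal (L_star P loss Y + 1 / real (Suc n))"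
    by (simp add: AE_all_countable)
  then show ?thesis
  proof eventually_elim
    case (elim \<omega>)
    have "(\<lambda>n. ereal (L_star P loss Y + 1 / real (Suc n))) \<longlonglongrightarrow> ereal (L_star P loss Y)"
      using LIMSEQ_inverse_real_of_nat_add[of "L_star P loss Y"] by (simp add: inverse_eq_divide)
    then show ?case by (rule LIMSEQ_le_const) (use elim in auto)
  qed
qed

end
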